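(* Suppose $\eta>0$ (duality condition). Let $0<b_1^\flat\le\dots\le b_{N_R}^\flat$ be the nonzero eigenvalues of $\eta^{-1}R$, repeated according to multiplicity. Then the $N_R$ low-loss eigenpairs $(\zeta_j(\beta),w_j(\beta))$, $N_R+1\le j\le 2N_R$, of $A(\beta)$ with $\lim_{\beta\to\infty}\zeta_j(\beta)=\rho_j=0$ can be reindexed so that, as $\beta\to\infty$, $$\zeta_j(\beta)=-\mathrm i\,\frac{1}{b_{j-N_R}^\flat}\,\beta^{-1}+O(\beta^{-2}),\qquad N_R+1\le j\le 2N_R .$$
   Context: Setting. $N\ge 1$; $\alpha,\eta,\theta,R$ are real $N\times N$ matrices with $\alpha^{\mathrm T}=\alpha>0$, $\eta^{\mathrm T}=\eta\ge0$, $\theta^{\mathrm T}=-\theta$, $R^{\mathrm T}=R\ge0$, and $N_R=\operatorname{rank}R>0$; $\beta\ge0$. $\sqrt{\cdot}$ denotes the positive semidefinite square root. On $H=\mathbb C^{2N}=\mathbb C^N\oplus\mathbb C^N$ set $$\Omega=\begin{bmatrix}-2\mathrm i\sqrt\alpha^{-1}\theta\sqrt\alpha^{-1} & -\mathrm i\Phi^{\mathrm T}\\ \mathrm i\Phi&0\end{bmatrix},\quad \Phi=\sqrt\eta\sqrt\alpha^{-1},\quad B=\begin{bmatrix}\sqrt\alpha^{-1}R\sqrt\alpha^{-1}&0\\0&0\end{bmatrix},\quad A(\beta)=\Omega-\mathrm i\beta B .$$ $\Omega$ is Hermitian, $B\ge0$, $\operatorname{rank}B=N_R$. Let $0<b_1\le\dots\le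 b_{N_R}$ be the nonzero eigenvalues of $B$ with multiplicity, $P_B^\perp$ the orthogonal projection onto $\operatorname{Ker}B$, $\Omega_1=P_B^\perp\Omega P_B^\perp|_{\operatorname{Ker}B}$. Eigenpairs for large $\beta$ (known facts). There is an orthonormal basis $\{\mathring w_j\}_{j=1}^{2N}$ of $H$ with $B\mathring w_j=b_j\mathring w_j$ for $1\le j\le N_R$ and $\mathring w_j\in\operatorname{Ker}B$, $\Omega_1\mathring w_j=\rho_j\mathring w_j$ for $N_R+1\le j\le 2N$, such that for all sufficiently large $\beta$ the operator $A(\beta)$ has a basis of eigenvectors $w_j(\beta)$, $A(\beta)w_j(\beta)=\zeta_j(\beta)w_j(\beta)$, where $w_j(\beta)=\mathring w_j+O(\beta^{-1})$ is a convergent power series in $\beta^{-1}$, and: (high-loss, $1\le j\le N_R$) $\zeta_j(\beta)=-\mathrm i b_j\beta+\rho_j+O(\beta^{-1})$, a convergent Laurent series in $\beta^{-1}$; (low-loss, $N_R+1\le j\le 2N$) $\zeta_j(\beta)=\rho_j-\mathrm i d_j\beta^{-1}+O(\beta^{-2})$, a convergent power series in $\beta^{-1}$, $d_j\ge0$. When $\eta>0$, exactly $N_R$ of the $\rho_j$ with $N_R+1\le j\le 2N$ are zero, and the low-loss eigenpairs are indexed so that these are $\rho_{N_R+1},\dots,\rho_{2N_R}$. *)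

theory Defs
  imports
    "HOL-Analysis.Analysis"
    "HOL-Computational_Algebra.Polynomial"
    "HOL-Library.Landau_Symbols"
begin

definition pos_semidef :: "real^'n^'n \<Rightarrow> bool" where
  "pos_semidef M \<longleftrightarrow> transpose M = M \<and> (\<forall>x. 0 \<le> x \<bullet> (M *v x))"

definition pos_def :: "real^'n^'n \<Rightarrow> bool" where
  "pos_def M \<longleftrightarrow> transpose M = M \<and> (\<forall>x. x \<noteq> 0 \<longrightarrow> 0 < x \<bullet> (M *v x))"

definition psd_sqrt :: "real^'n^'n \<Rightarrow> real^'n^'n" where
  "psd_sqrt M = (THE S. pos_semidef S \<and> S ** S = M)"

abbreviation cmat :: "real^'n^'m \<Rightarrow> complex^'n^'m" where
  "cmat \<equiv> map_matrix complex_of_real"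

abbreviation scale_mat :: "complex \<Rightarrow> complex^'n^'m \<Rightarrow> complex^'n^'m" where
  "scale_mat c \<equiv> map_matrix ((*) c)"

definition block_mat ::
  "'a^'n^'m \<Rightarrow> 'a^'p^'m \<Rightarrow> 'a^'n^'q \<Rightarrow> 'a^'p^'q \<Rightarrow> 'a^('n + 'p)^('m + 'q)" where
  "block_mat M11 M12 M21 M22 = (\<chi> i j.
     case i of
       Inl a \<Rightarrow> (case j of Inl c \<Rightarrow> M11 $ a $ c | Inr c \<Rightarrow> M12 $ a $ c)
     | Inr a \<Rightarrow> (case j of Inl c \<Rightarrow> M21 $ a $ c | Inr c \<Rightarrow> M22 $ a $ c))"

text \<open>
  The space \<open>H\<close> is \<^typ>\<open>complex^('n + 'n)\<close>, with \<^const>\<open>Inl\<close> and \<^const>\<open>Inr\<close> indexing the two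
  copies of the \<open>N\<close>-dimensional space.
\<close>

definition Phi :: "real^'n^'n \<Rightarrow> real^'n^'n \<Rightarrow> real^'n^'n" where
  "Phi \<alpha> \<eta> = psd_sqrt \<eta> ** matrix_inv (psd_sqrt \<alpha>)"

definition Omega_op ::
  "real^'n^'n \<Rightarrow> real^'n^'n \<Rightarrow> real^'n^'n \<Rightarrow> complex^('n + 'n)^('n + 'n)" where
  "Omega_op \<alpha> \<eta> \<theta> = block_mat
     (scale_mat (- 2 * \<i>) (cmat (matrix_inv (psd_sqrt \<alpha>) ** \<theta> ** matrix_inv (psd_sqrt \<alpha>))))
     (scale_mat (- \<i>) (cmat (transpose (Phi \<alpha> \<eta>))))
     (scale_mat \<i> (cmat (Phi \<alpha> \<eta>)))
     0"

definition B_op :: "real^'n^'n \<Rightarrow> real^'n^'n \<Rightarrow> complex^('n + 'n)^('n + 'n)" where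
  "B_op \<alpha> R = block_mat
     (cmat (matrix_inv (psd_sqrt \<alpha>) ** R ** matrix_inv (psd_sqrt \<alpha>))) 0 0 0"

definition system_op :: "complex^'m^'m \<Rightarrow> complex^'m^'m \<Rightarrow> real \<Rightarrow> complex^'m^'m" where
  "system_op \<Omega> B \<beta> = \<Omega> - scale_mat (\<i> * complex_of_real \<beta>) B"

definition cinner :: "complex^'m \<Rightarrow> complex^'m \<Rightarrow> complex" where
  "cinner x y = (\<Sum>i\<in>UNIV. cnj (x $ i) * y $ i)"

definition adjoint_mat :: "complex^'n^'m \<Rightarrow> complex^'m^'n" where
  "adjoint_mat M = map_matrix cnj (transpose M)"

definition kernel :: "complex^'n^'m \<Rightarrow> (complex^'n) set" where
  "kernel M = {x. M *v x = 0}"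

definition orth_proj :: "(complex^'m) set \<Rightarrow> complex^'m^'m" where
  "orth_proj V = (THE P. adjoint_mat P = P \<and> P ** P = P \<and> range ((*v) P) = V)"

definition orthonormal_basis :: "nat \<Rightarrow> (nat \<Rightarrow> complex^'m) \<Rightarrow> bool" where
  "orthonormal_basis n u \<longleftrightarrow>
     (\<forall>i\<in>{1..n}. \<forall>j\<in>{1..n}. cinner (u i) (u j) = (if i = j then 1 else 0)) \<and>
     vec.span (u ` {1..n}) = UNIV"

definition is_basis :: "nat \<Rightarrow> (nat \<Rightarrow> complex^'m) \<Rightarrow> bool" where
  "is_basis n u \<longleftrightarrow>
     inj_on u {1..n} \<and> vec.independent (u ` {1..n}) \<and> vec.span (u ` {1..n}) = UNIV"

definition charpoly :: "complex^'m^'m \<Rightarrow> complex poly" where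
  "charpoly M = det (mat [:0, 1:] - map_matrix (\<lambda>x. [:x:]) M)"

text \<open>
  The nonzero eigenvalues of \<open>M\<close>, repeated according to (algebraic) multiplicity, are
  \<open>0 < b 1 \<le> \<dots> \<le> b k\<close>. In particular all nonzero eigenvalues are real and positive.
\<close>

definition nonzero_eigenvalues :: "complex^'m^'m \<Rightarrow> nat \<Rightarrow> (nat \<Rightarrow> real) \<Rightarrow> bool" where
  "nonzero_eigenvalues M k b \<longleftrightarrow>
     (\<forall>j\<in>{1..k}. 0 < b j) \<and> mono_on {1..k} b \<and>
     (\<forall>z. z \<noteq> 0 \<longrightarrow>
        card {j\<in>{1..k}. complex_of_real (b j) = z} = order z (charpoly M))"

text \<open>
  Convergent expansions in \<open>1 / \<beta>\<close> near \<open>\<beta> = \<infinity>\<close>; a Laurent series has finitely many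
  positive powers of \<open>\<beta>\<close>.
\<close>

definition power_series_at_infinity :: "(real \<Rightarrow> 'a::real_normed_vector) \<Rightarrow> bool" where
  "power_series_at_infinity f \<longleftrightarrow>
     (\<exists>c. \<forall>\<^sub>F \<beta> in at_top. (\<lambda>n. (1 / \<beta>) ^ n *\<^sub>R c n) sums f \<beta>)"

definition laurent_series_at_infinity :: "(real \<Rightarrow> 'a::real_normed_vector) \<Rightarrow> bool" where
  "laurent_series_at_infinity f \<longleftrightarrow>
     (\<exists>m::nat. power_series_at_infinity (\<lambda>\<beta>. (1 / \<beta>) ^ m *\<^sub>R f \<beta>))"

text \<open>
  The eigenpairs \<open>(\<zeta> j, w j)\<close>, \<open>1 \<le> j \<le> dim H\<close>, of \<open>\<Omega> - \<i>\<beta>B\<close> for large \<open>\<beta>\<close>, where \<open>B\<close> has the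
  \<open>k\<close> nonzero eigenvalues \<open>b 1 \<le> \<dots> \<le> b k\<close>, with limiting eigenvectors \<open>w0 j\<close>: the high-loss
  ones are those with \<open>j \<le> k\<close>, the low-loss ones those with \<open>k < j\<close>.
\<close>

definition eigenpair_asymptotics ::
  "complex^'m^'m \<Rightarrow> complex^'m^'m \<Rightarrow> nat \<Rightarrow> (nat \<Rightarrow> real) \<Rightarrow> (nat \<Rightarrow> complex^'m) \<Rightarrow>
   (nat \<Rightarrow> real) \<Rightarrow> (nat \<Rightarrow> real) \<Rightarrow> (nat \<Rightarrow> real \<Rightarrow> complex) \<Rightarrow> (nat \<Rightarrow> real \<Rightarrow> complex^'m) \<Rightarrow> bool"
where
  "eigenpair_asymptotics \<Omega> B k b w0 \<rho> d \<zeta> w \<longleftrightarrow>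
     nonzero_eigenvalues B k b \<and>
     orthonormal_basis CARD('m) w0 \<and>
     (\<forall>j\<in>{1..k}. B *v w0 j = complex_of_real (b j) *s w0 j) \<and>
     (\<forall>j\<in>{k+1..CARD('m)}. w0 j \<in> kernel B \<and>
        (orth_proj (kernel B) ** \<Omega> ** orth_proj (kernel B)) *v w0 j
          = complex_of_real (\<rho> j) *s w0 j) \<and>
     (\<forall>\<^sub>F \<beta> in at_top.
        is_basis CARD('m) (\<lambda>j. w j \<beta>) \<and>
        (\<forall>j\<in>{1..CARD('m)}. system_op \<Omega> B \<beta> *v w j \<beta> = \<zeta> j \<beta> *s w j \<beta>)) \<and>
     (\<forall>j\<in>{1..CARD('m)}.
        power_series_at_infinity (w j) \<and>
        (\<lambda>\<beta>. norm (w j \<beta> - w0 j)) \<in> O[at_top](\<lambda>\<beta>. 1 / \<beta>)) \<and>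
     (\<forall>j\<in>{1..k}.
        laurent_series_at_infinity (\<zeta> j) \<and>
        (\<lambda>\<beta>. \<zeta> j \<beta> - (- \<i> * complex_of_real (b j * \<beta>) + complex_of_real (\<rho> j)))
          \<in> O[at_top](\<lambda>\<beta>. complex_of_real (1 / \<beta>))) \<and>
     (\<forall>j\<in>{k+1..CARD('m)}.
        0 \<le> d j \<and>
        power_series_at_infinity (\<zeta> j) \<and>
        (\<lambda>\<beta>. \<zeta> j \<beta> - (complex_of_real (\<rho> j) - \<i> * complex_of_real (d j / \<beta>)))
          \<in> O[at_top](\<lambda>\<beta>. complex_of_real (1 / \<beta>\<^sup>2)))"

end

theory Submission
  imports Defs
begin

text \<open>
  The spectrum of \<open>A(\<beta>)\<close> is given by a quadratic pencil:
  \<open>det \<alpha> \<cdot> (\<Prod>j. z - \<zeta>\<^sub>j(\<beta>)) = det (z\<^sup>2 \<alpha> + 2 \<i> z \<theta> + \<i> \<beta> z R - \<eta>)\<close>.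
  Put \<open>z = s / \<beta>\<close> and let \<open>\<beta> \<rightarrow> \<infinity>\<close>. The \<open>rank R\<close> high-loss factors grow like \<open>\<beta>\<close> and the
  \<open>rank R\<close> factors with \<open>\<rho>\<^sub>j = 0\<close> decay like \<open>1 / \<beta>\<close>, so the powers of \<open>\<beta>\<close> cancel and
  \<open>det (\<i> s R - \<eta>) = C (\<Prod>j. s + \<i> d\<^sub>j)\<close> with \<open>C \<noteq> 0\<close>, the product being over the latter
  indices. Since \<open>\<eta>\<close> is invertible, no \<open>d\<^sub>j\<close> vanishes, and the substitution \<open>s = -\<i> / \<lambda>\<close>
  identifies the numbers \<open>1 / d\<^sub>j\<close> with the nonzero eigenvalues of \<open>\<eta>\<^sup>-\<^sup>1 R\<close>.
\<close>

subsection \<open>Determinants of block matrices\<close>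

text \<open>In a row \<open>Inr c\<close> only the diagonal entry can be nonzero, so the Leibniz sum
  reduces to the permutations fixing every \<open>Inr c\<close>. These correspond to the
  permutations of the first index type, with equal signs.\<close>

lemma det_block_mat_one:
  fixes A :: "'a::comm_ring_1^'n^'n"
  shows "det (block_mat A 0 0 (mat 1) :: 'a^('n + 'm::finite)^('n + 'm)) = det A"
proof -
  let ?M = "block_mat A 0 0 (mat 1) :: 'a^('n + 'm::finite)^('n + 'm)"
  let ?I = "range Inl :: ('n + 'm) set"
  let ?f = "map_permutation UNIV (Inl :: 'n \<Rightarrow> 'n + 'm)"
  let ?t = "\<lambda>p. of_int (sign p) * (\<Prod>i\<in>UNIV. ?M $ i $ p i)"
  have bij_Inl: "bij_betw (Inl :: 'n \<Rightarrow> 'n + 'm) UNIV ?I"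
    by (simp add: bij_betw_def)
  have bij_projl: "bij_betw projl ?I (UNIV :: 'n set)"
    by (force simp: bij_betw_def inj_on_def)
  have bij: "bij_betw ?f {p. p permutes UNIV} {p. p permutes ?I}"
    by (rule bij_betw_byWitness[where f' = "map_permutation ?I projl"])
      (auto intro: map_permutation_compose_inv[OF bij_Inl] map_permutation_compose_inv[OF bij_projl]
        map_permutation_permutes[OF bij_Inl] map_permutation_permutes[OF bij_projl])
  have vanish: "?t p = 0" if p: "p permutes UNIV" "\<not> p permutes ?I" for p :: "'n + 'm \<Rightarrow> 'n + 'm"
  proof -
    obtain i where "i \<notin> ?I" "p i \<noteq> i"
      using p permutes_superset[of p UNIV ?I] by blast
    then obtain c where c: "p (Inr c) \<noteq> Inr c"
      by (cases i) auto
    then have "?M $ Inr c $ p (Inr c) = 0"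
      by (cases "p (Inr c)") (auto simp: block_mat_def mat_def)
    then show ?thesis
      by (metis (mono_tags, lifting) finite UNIV_I prod_zero mult_zero_right)
  qed
  have "det ?M = (\<Sum>p | p permutes UNIV. ?t p)"
    by (simp add: det_def)
  also have "\<dots> = (\<Sum>p | p permutes ?I. ?t p)"
    by (rule sum.mono_neutral_right)
      (use vanish in \<open>auto intro: permutes_subset[OF _ subset_UNIV]\<close>)
  also have "\<dots> = (\<Sum>p | p permutes UNIV. ?t (?f p))"
    by (rule sum.reindex_bij_betw[OF bij, symmetric])
  also have "\<dots> = det A"
    unfolding det_def
  proof (rule sum.cong[OF refl])
    fix p :: "'n \<Rightarrow> 'n" assume "p \<in> {p. p permutes UNIV}"
    then have p: "p permutes UNIV" by simp
    have fl: "?f p (Inl a) = Inl (p a)" for a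
      by (simp add: map_permutation_apply)
    have fr: "?f p (Inr c) = Inr c" for c
      using map_permutation_permutes[OF bij_Inl p] by (rule permutes_not_in) auto
    have "(\<Prod>i\<in>UNIV. ?M $ i $ ?f p i) = (\<Prod>i\<in>UNIV. A $ i $ p i)"
      unfolding UNIV_Plus_UNIV[symmetric]
      by (subst prod.Plus) (simp_all add: fl fr block_mat_def mat_def)
    then show "?t (?f p) = of_int (sign p) * (\<Prod>i\<in>UNIV. A $ i $ p i)"
      using p by (simp add: sign_map_permutation)
  qed
  finally show ?thesis .
qed

lemma block_mat_mult:
  fixes A :: "'a::semiring_1^'n^'m" and B :: "'a^'p^'m" and C :: "'a^'n^'q" and D :: "'a^'p^'q"
    and A' :: "'a^'r^'n" and B' :: "'a^'s^'n" and C' :: "'a^'r^'p" and D' :: "'a^'s^'p"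
  shows "block_mat A B C D ** block_mat A' B' C' D' =
    block_mat (A ** A' + B ** C') (A ** B' + B ** D') (C ** A' + D ** C') (C ** B' + D ** D')"
proof -
  have *: "(\<Sum>k\<in>UNIV. f k) = (\<Sum>k\<in>UNIV. f (Inl k)) + (\<Sum>k\<in>UNIV. f (Inr k))"
    for f :: "'n + 'p \<Rightarrow> 'a"
    unfolding UNIV_Plus_UNIV[symmetric] by (subst sum.Plus) simp_all
  show ?thesis
    unfolding vec_eq_iff
    by (auto simp: matrix_matrix_mult_def block_mat_def * split: sum.splits)
qed

lemma det_block_mat_diag:
  fixes A :: "'a::comm_ring_1^'n^'n"
  shows "det (block_mat A 0 0 (mat c) :: 'a^('n + 'm::finite)^('n + 'm)) = det A * c ^ CARD('m)"
proof -
  let ?D = "block_mat (mat 1) 0 0 (mat c) :: 'a^('n + 'm::finite)^('n + 'm)"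
  have "det ?D = (\<Prod>i\<in>UNIV. ?D $ i $ i)"
    by (rule det_diagonal) (auto simp: block_mat_def mat_def split: sum.splits)
  also have "\<dots> = c ^ CARD('m)"
    unfolding UNIV_Plus_UNIV[symmetric] by (subst prod.Plus) (simp_all add: block_mat_def mat_def)
  finally have D: "det ?D = c ^ CARD('m)" .
  have "block_mat A 0 0 (mat c) = block_mat A 0 0 (mat 1) ** ?D"
    by (simp add: block_mat_mult)
  then show ?thesis
    by (simp add: det_mul det_block_mat_one D)
qed

lemma block_mat_one: "block_mat (mat 1) 0 0 (mat 1) = mat 1"
  by (auto simp: vec_eq_iff block_mat_def mat_def split: sum.splits)

lemma mat_mult: "mat c ** A = (\<chi> i j. c * A $ i $ j)"
  for A :: "'a::semiring_1^'n^'m"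
  by (simp add: vec_eq_iff matrix_matrix_mult_def mat_def if_distrib if_distribR sum.delta'
      cong: if_cong)

lemma mat_mult_mat: "mat c ** mat d = (mat (c * d) :: 'a::semiring_1^'n^'n)"
  unfolding mat_mult by (simp add: vec_eq_iff mat_def)

lemma mult_mat: "A ** mat c = (\<chi> i j. A $ i $ j * c)"
  for A :: "'a::semiring_1^'n^'m"
  by (simp add: vec_eq_iff matrix_matrix_mult_def mat_def if_distrib if_distribR sum.delta
      cong: if_cong)

lemma mat_mult_commute: "mat c ** A = A ** mat c"
  for A :: "'a::comm_semiring_1^'n^'m"
  by (simp add: mat_mult mult_mat mult.commute)

lemma det_mat: "det (mat c :: 'a::comm_ring_1^'n^'n) = c ^ CARD('n)"
  by (subst det_diagonal) (simp_all add: mat_def)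

text \<open>
  Conjugation by the invertible matrix diag(2, 1) squares a unipotent block matrix, so its
  determinant is a nonzero idempotent.
\<close>

lemma det_block_mat_upper:
  fixes X :: "'a::field_char_0^'m^'n"
  shows "det (block_mat (mat 1) X 0 (mat 1) :: 'a^('n + 'm::finite)^('n + 'm)) = 1"
proof -
  let ?U = "\<lambda>X. block_mat (mat 1) X 0 (mat 1) :: 'a^('n + 'm::finite)^('n + 'm)"
  let ?D = "block_mat (mat 2) 0 0 (mat 1) :: 'a^('n + 'm::finite)^('n + 'm)"
  have "?U X ** ?U (- X) = mat 1"
    by (simp add: block_mat_mult block_mat_one)
  then have nz: "det (?U X) \<noteq> 0"
    using det_mul[of "?U X" "?U (- X)"] by auto
  have two: "mat 2 ** X = X + X"
    by (simp only: mat_mult vec_eq_iff vector_add_component vec_lambda_beta mult_2 simp_thms)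
  have "?D ** ?U X = ?U X ** ?U X ** ?D"
    by (simp add: block_mat_mult two)
  then have "det ?D * det (?U X) = det (?U X) * det (?U X) * det ?D"
    by (simp flip: det_mul)
  moreover have "det ?D \<noteq> 0"
    by (simp add: det_block_mat_one det_mat)
  ultimately show ?thesis
    using nz by simp
qed

lemma det_block_mat_lower:
  fixes X :: "'a::field_char_0^'n^'m"
  shows "det (block_mat (mat 1) 0 X (mat 1) :: 'a^('n + 'm::finite)^('n + 'm)) = 1"
proof -
  have "transpose (block_mat (mat 1) 0 X (mat 1)) =
      (block_mat (mat 1) (transpose X) 0 (mat 1) :: 'a^('n + 'm::finite)^('n + 'm))"
    by (auto simp: vec_eq_iff transpose_def block_mat_def mat_def split: sum.splits)
  then show ?thesis
    using det_transpose[of "block_mat (mat 1) 0 X (mat 1) :: 'a^('n + 'm)^('n + 'm)"]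
    by (simp add: det_block_mat_upper)
qed

section \<open>Distributive laws and the Schur complement\<close>

lemma matrix_diff_ldistrib: "A ** (B - C) = A ** B - A ** C"
  for A :: "'a::ring_1^'n^'m"
  by (simp add: vec_eq_iff matrix_matrix_mult_def right_diff_distrib sum_subtractf)

lemma matrix_add_rdistrib: "(B + C) ** A = B ** A + C ** A"
  for A :: "'a::ring_1^'n^'m"
  by (simp add: vec_eq_iff matrix_matrix_mult_def distrib_right sum.distrib)

lemma matrix_diff_rdistrib: "(B - C) ** A = B ** A - C ** A"
  for A :: "'a::ring_1^'n^'m"
  by (simp add: vec_eq_iff matrix_matrix_mult_def left_diff_distrib sum_subtractf)

text \<open>This is the Schur complement of the scalar block \<open>mat z\<close>. The power of
  \<open>z\<close> contributed by that block is absorbed into the complement, which leaves an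
  expression free of 1/z.\<close>

lemma det_block_mat_scalar:
  fixes P :: "'a::field_char_0^'n^'n" and Q :: "'a^'n^'n" and T :: "'a^'n^'n"
  assumes "z \<noteq> 0"
  shows "det (block_mat P Q T (mat z)) = det (mat z ** P - Q ** T)"
proof -
  let ?c = "mat (inverse z) :: 'a^'n^'n"
  have c: "?c ** mat z = mat 1" "mat z ** ?c = mat 1"
    using assms by (simp_all add: mat_mult_mat)
  have cQ: "Q ** ?c = ?c ** Q"
    by (rule mat_mult_commute[symmetric])
  have cQz: "?c ** Q ** mat z = Q"
    by (metis c(1) cQ matrix_mul_assoc matrix_mul_rid)
  \<comment> \<open>Factorization into an upper unipotent, a block diagonal and a lower unipotent
    matrix; only the middle one affects the determinant.\<close>
  have "block_mat P Q T (mat z) =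
    block_mat (mat 1) (Q ** ?c) 0 (mat 1) **
      (block_mat (P - ?c ** Q ** T) 0 0 (mat z) ** block_mat (mat 1) 0 (?c ** T) (mat 1))"
    by (simp add: block_mat_mult matrix_mul_assoc c cQ cQz)
  then have "det (block_mat P Q T (mat z)) = det (P - ?c ** Q ** T) * z ^ CARD('n)"
    by (simp add: det_mul det_block_mat_upper det_block_mat_lower det_block_mat_diag)
  also have "\<dots> = det (mat z ** (P - ?c ** Q ** T))"
    by (simp add: det_mul det_mat)
  also have "mat z ** (P - ?c ** Q ** T) = mat z ** P - Q ** T"
    by (simp add: matrix_diff_ldistrib matrix_mul_assoc c)
  finally show ?thesis .
qed

subsection \<open>Positive semidefinite square roots\<close>

lemma transpose_eq_self_iff:
  fixes M :: "real^'n^'n"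
  shows "transpose M = M \<longleftrightarrow> (\<forall>x y. (M *v x) \<bullet> y = x \<bullet> (M *v y))"
proof
  assume "transpose M = M"
  then show "\<forall>x y. (M *v x) \<bullet> y = x \<bullet> (M *v y)"
    by (metis dot_lmul_matrix transpose_matrix_vector)
next
  assume *: "\<forall>x y. (M *v x) \<bullet> y = x \<bullet> (M *v y)"
  have "(transpose M *v x) \<bullet> y = (M *v x) \<bullet> y" for x y
    by (simp add: * dot_lmul_matrix transpose_matrix_vector)
  then show "transpose M = M"
    by (metis matrix_eq vector_eq_rdot)
qed

text \<open>At a maximizer of the Rayleigh quotient on \<open>V\<close> the first-order variation
  vanishes in every direction of \<open>V\<close>. It suffices to test the residual
  \<open>g\<close>, which lies in \<open>V\<close> by invariance.\<close>

lemma self_adjoint_maximizer_eigenvector: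
  fixes f :: "'a::euclidean_space \<Rightarrow> 'a"
  assumes f: "linear f" and adj: "\<And>x y. f x \<bullet> y = x \<bullet> f y"
    and V: "subspace V" "f ` V \<subseteq> V"
    and u: "u \<in> V" "norm u = 1" and le: "\<And>y. y \<in> V \<Longrightarrow> y \<bullet> f y \<le> (u \<bullet> f u) * (y \<bullet> y)"
  shows "f u = (u \<bullet> f u) *\<^sub>R u"
proof -
  define l g where "l = u \<bullet> f u" and "g = f u - l *\<^sub>R u"
  have gV: "g \<in> V"
    using V u by (auto simp: g_def intro!: subspace_diff subspace_scale)
  define K where "K = l * (g \<bullet> g) - g \<bullet> f g"
  have uu: "u \<bullet> u = 1"
    using u by (simp add: dot_square_norm)
  \<comment> \<open>Maximality is tested at the point \<open>u + t *\<^sub>R g\<close>. The linear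
    terms combine to 2 t |g|^2 because
    \<open>g \<bullet> f u = g \<bullet> g + l * (g \<bullet> u)\<close>.\<close>
  have key: "2 * t * (g \<bullet> g) \<le> t\<^sup>2 * K" for t
  proof -
    have "u + t *\<^sub>R g \<in> V"
      using V u gV by (auto intro: subspace_add subspace_scale)
    from le[OF this] have "l + 2 * t * (g \<bullet> f u) + t\<^sup>2 * (g \<bullet> f g)
        \<le> l * (1 + 2 * t * (g \<bullet> u) + t\<^sup>2 * (g \<bullet> g))"
      using adj[of u g]
      by (simp add: linear_add[OF f] linear_scale[OF f] inner_add inner_commute uu
          flip: l_def) (simp add: algebra_simps power2_eq_square inner_commute)
    moreover have "g \<bullet> f u = g \<bullet> g + l * (g \<bullet> u)"
      by (simp add: g_def inner_diff)
    moreover have alg: "2 * t * G \<le> t\<^sup>2 * (l * G - h)"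
      if "l + 2 * t * q + t\<^sup>2 * h \<le> l * (1 + 2 * t * p + t\<^sup>2 * G)" "q = G + l * p" for p q h G
      using that(1) unfolding that(2) by (simp add: algebra_simps)
    ultimately show ?thesis
      unfolding K_def by (intro alg)
  qed
  have "g \<bullet> g \<le> 0"
  proof (cases "K \<le> 0")
    case True
    then show ?thesis using key[of 1] by simp
  next
    case False
    \<comment> \<open>For \<open>K\<close> > 0 this value of \<open>t\<close> minimizes t^2 K - 2 t
      |g|^2, and the inequality there forces |g|^4 \<le> 0.\<close>
    with key[of "(g \<bullet> g) / K"] have "(g \<bullet> g)\<^sup>2 \<le> 0"
      by (simp add: power2_eq_square field_simps)
    then show ?thesis
      by simp
  qed
  then have "g = 0"
    by (metis inner_eq_zero_iff inner_ge_zero order_antisym)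
  then show ?thesis
    by (simp add: g_def l_def)
qed

text \<open>Induction on \<open>dim V\<close>: a unit eigenvector is split off, and its orthogonal
  complement in \<open>V\<close> is again invariant. Speaking of invariant subspaces instead of the
  whole space lets the induction run.\<close>

lemma self_adjoint_orthonormal_eigenbasis:
  fixes f :: "'a::euclidean_space \<Rightarrow> 'a"
  assumes f: "linear f" and adj: "\<And>x y. f x \<bullet> y = x \<bullet> f y"
    and V: "subspace V" "f ` V \<subseteq> V"
  shows "\<exists>B. finite B \<and> pairwise orthogonal B \<and> span B = V \<and>
    (\<forall>e\<in>B. norm e = 1 \<and> f e = (e \<bullet> f e) *\<^sub>R e)"
  using V
proof (induction "dim V" arbitrary: V rule: less_induct)
  case less
  show ?case
  proof (cases "V \<subseteq> {0}")
    case True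
    then have "V = {0}"
      using less.prems subspace_0 by blast
    then show ?thesis
      by (intro exI[of _ "{}"]) auto
  next
    case False
    let ?S = "sphere 0 1 \<inter> V"
    obtain v where "v \<in> V" "v \<noteq> 0"
      using False by blast
    then have "v /\<^sub>R norm v \<in> ?S"
      using less.prems by (auto intro: subspace_scale)
    moreover have "compact ?S"
      using less.prems by (intro compact_Int_closed closed_subspace compact_sphere) auto
    moreover have "continuous_on ?S (\<lambda>y. y \<bullet> f y)"
      using f by (intro continuous_intros linear_continuous_on)
        (simp add: linear_conv_bounded_linear)
    ultimately obtain u where u: "u \<in> ?S" and max: "\<And>y. y \<in> ?S \<Longrightarrow> y \<bullet> f y \<le> u \<bullet> f u"
      using continuous_attains_sup[of ?S "\<lambda>y. y \<bullet> f y"] by blast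
    have nu: "norm u = 1" and uV: "u \<in> V"
      using u by auto
    \<comment> \<open>Homogeneity of degree two extends the bound from the unit sphere to all of
      \<open>V\<close>.\<close>
    have le: "y \<bullet> f y \<le> (u \<bullet> f u) * (y \<bullet> y)" if "y \<in> V" for y
    proof (cases "y = 0")
      case False
      have "y /\<^sub>R norm y \<in> ?S"
        using False that less.prems by (auto intro: subspace_scale)
      from max[OF this] show ?thesis
        using False
        by (simp add: linear_scale[OF f] dot_square_norm power2_eq_square divide_simps mult_ac)
    qed simp
    have fu: "f u = (u \<bullet> f u) *\<^sub>R u"
      by (rule self_adjoint_maximizer_eigenvector[OF f adj less.prems uV nu le])
    define W where "W = V \<inter> {y. u \<bullet> y = 0}"
    have W: "subspace W"
      unfolding W_def using less.prems by (intro subspace_inter subspace_hyperplane)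
    have fW: "f ` W \<subseteq> W"
    proof -
      \<comment> \<open>By self-adjointness \<open>u \<bullet> f y = f u \<bullet> y\<close>, which
        is a multiple of \<open>u \<bullet> y\<close>.\<close>
      have "u \<bullet> f y = 0" if "u \<bullet> y = 0" for y
        using that fu adj[of u y] by (metis inner_scaleR_left mult_zero_right)
      then show ?thesis
        using less.prems by (auto simp: W_def)
    qed
    have "u \<notin> W"
      using nu by (auto simp: W_def)
    then have "W \<subset> V"
      using uV unfolding W_def by blast
    then have "dim W < dim V"
      using W less.prems by (metis dim_psubset span_eq_iff)
    then obtain B where B: "finite B" "pairwise orthogonal B" "span B = W"
      "\<forall>e\<in>B. norm e = 1 \<and> f e = (e \<bullet> f e) *\<^sub>R e"
      using less.hyps[OF _ W fW] by blast
    have BW: "B \<subseteq> W"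
      using B span_superset by blast
    have "span (insert u B) = V"
    proof
      show "span (insert u B) \<subseteq> V"
        using BW uV less.prems by (intro span_minimal) (auto simp: W_def)
      show "V \<subseteq> span (insert u B)"
      proof
        fix x assume "x \<in> V"
        then have "x - (u \<bullet> x) *\<^sub>R u \<in> W"
          using less.prems uV nu
          by (auto simp: W_def inner_diff dot_square_norm intro!: subspace_diff subspace_scale)
        then show "x \<in> span (insert u B)"
          unfolding span_insert using B by auto
      qed
    qed
    moreover have "pairwise orthogonal (insert u B)"
      using B(2) BW by (auto simp: pairwise_insert W_def orthogonal_def inner_commute)
    ultimately show ?thesis
      using B nu fu by (intro exI[of _ "insert u B"]) auto
  qed
qed

lemma symmetric_matrix_eigenbasis:
  fixes M :: "real^'n^'n"
  assumes "transpose M = M"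
  shows "\<exists>B. finite B \<and> pairwise orthogonal B \<and> span B = UNIV \<and>
    (\<forall>e\<in>B. norm e = 1 \<and> M *v e = (e \<bullet> (M *v e)) *\<^sub>R e)"
  using assms unfolding transpose_eq_self_iff
  by (intro self_adjoint_orthonormal_eigenbasis matrix_vector_mul_linear) auto

section \<open>Existence and uniqueness of the positive semidefinite root\<close>

lemma matrix_eq_on_span:
  fixes A C :: "real^'n^'m"
  assumes "span B = UNIV" "\<And>e. e \<in> B \<Longrightarrow> A *v e = C *v e"
  shows "A = C"
  using linear_eq_on_span[OF matrix_vector_mul_linear matrix_vector_mul_linear assms(2)] assms(1)
  by (auto simp: matrix_eq)

text \<open>The root is the sum, over an orthonormal eigenbasis, of the rank-one projections onto
  the eigenvectors, weighted by the square roots of the eigenvalues.\<close>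

lemma pos_semidef_sqrt_exists:
  assumes "pos_semidef M"
  shows "\<exists>S. pos_semidef S \<and> S ** S = M"
proof -
  obtain B where B: "finite B" "pairwise orthogonal B" "span B = UNIV"
    "\<forall>e\<in>B. norm e = 1 \<and> M *v e = (e \<bullet> (M *v e)) *\<^sub>R e"
    using assms symmetric_matrix_eigenbasis[of M] unfolding pos_semidef_def by blast
  define c where "c e = sqrt (e \<bullet> (M *v e))" for e
  define S where "S = (\<chi> i j. \<Sum>e\<in>B. c e * e $ i * e $ j)"
  have c: "c e \<ge> 0" "c e * c e = e \<bullet> (M *v e)" for e
    using assms by (auto simp: c_def pos_semidef_def)
  have S: "S *v x = (\<Sum>e\<in>B. (c e * (e \<bullet> x)) *\<^sub>R e)" for x
  proof -
    have "(\<Sum>j\<in>UNIV. (\<Sum>e\<in>B. c e * e $ i * e $ j) * x $ j) =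
        (\<Sum>e\<in>B. c e * (\<Sum>j\<in>UNIV. e $ j * x $ j) * e $ i)" for i
      unfolding sum_distrib_left sum_distrib_right by (subst sum.swap) (simp only: mult_ac)
    then show ?thesis
      by (simp add: vec_eq_iff S_def matrix_vector_mult_def inner_vec_def)
  qed
  have Se: "S *v e = c e *\<^sub>R e" if "e \<in> B" for e
  proof -
    have "S *v e = (\<Sum>k\<in>B. if k = e then c e *\<^sub>R e else 0)"
      unfolding S using B that
      by (intro sum.cong) (auto simp: pairwise_def orthogonal_def dot_square_norm)
    then show ?thesis
      using B that by simp
  qed
  have "S ** S = M"
    by (rule matrix_eq_on_span[OF B(3)])
      (use B(4) in \<open>simp add: Se c matrix_vector_mult_scaleR flip: matrix_vector_mul_assoc\<close>)
  moreover have "transpose S = S"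
    by (simp add: S_def transpose_def mult_ac)
  moreover have "0 \<le> x \<bullet> (S *v x)" for x
    unfolding S inner_sum_right
    by (intro sum_nonneg) (simp add: c mult.assoc inner_commute)
  ultimately show ?thesis
    unfolding pos_semidef_def by blast
qed

text \<open>For \<open>l = 0\<close>, |S e|^2 is the inner product of \<open>e\<close> with S^2 e,
  which is zero. For \<open>l > 0\<close>, S^2 - l factors as (S + sqrt l)(S - sqrt l), and the
  first factor is positive definite. Uniqueness of the root rests on this.\<close>

lemma pos_semidef_sqrt_eigenvector:
  assumes S: "pos_semidef S" and l: "l \<ge> 0" and e: "(S ** S) *v e = l *\<^sub>R e"
  shows "S *v e = sqrt l *\<^sub>R e"
proof (cases "l = 0")
  case True
  have "(S *v e) \<bullet> (S *v e) = e \<bullet> ((S ** S) *v e)"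
    using S unfolding pos_semidef_def transpose_eq_self_iff
    by (simp flip: matrix_vector_mul_assoc)
  then show ?thesis
    using True e by simp
next
  case False
  define v where "v = S *v e - sqrt l *\<^sub>R e"
  have "S *v v + sqrt l *\<^sub>R v = 0"
    using l e by (simp add: v_def matrix_vector_mult_diff_distrib matrix_vector_mult_scaleR
        matrix_vector_mul_assoc scaleR_diff_right)
  then have "v \<bullet> (S *v v) + sqrt l * (v \<bullet> v) = 0"
    by (metis inner_add_right inner_scaleR_right inner_zero_right)
  moreover have "v \<bullet> (S *v v) \<ge> 0" "sqrt l * (v \<bullet> v) \<ge> 0"
    using S l by (auto simp: pos_semidef_def)
  ultimately have "sqrt l * (v \<bullet> v) = 0"
    by linarith
  then show ?thesis
    using False by (simp add: v_def)
qed

text \<open>The description defining \<open>psd_sqrt\<close> is proper: any two roots agree on an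
  eigenbasis of \<open>M\<close>.\<close>

lemma psd_sqrt:
  assumes "pos_semidef M"
  shows "pos_semidef (psd_sqrt M)" "psd_sqrt M ** psd_sqrt M = M"
proof -
  obtain B where B: "finite B" "pairwise orthogonal B" "span B = UNIV"
    "\<forall>e\<in>B. norm e = 1 \<and> M *v e = (e \<bullet> (M *v e)) *\<^sub>R e"
    using assms symmetric_matrix_eigenbasis[of M] unfolding pos_semidef_def by blast
  have "S = T" if "pos_semidef S" "S ** S = M" "pos_semidef T" "T ** T = M" for S T
  proof (rule matrix_eq_on_span[OF B(3)])
    fix e assume "e \<in> B"
    moreover have "e \<bullet> (M *v e) \<ge> 0"
      using assms by (simp add: pos_semidef_def)
    ultimately show "S *v e = T *v e"
      using B(4) that pos_semidef_sqrt_eigenvector by metis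
  qed
  then have "\<exists>!S. pos_semidef S \<and> S ** S = M"
    using pos_semidef_sqrt_exists[OF assms] by blast
  from theI'[OF this] show "pos_semidef (psd_sqrt M)" "psd_sqrt M ** psd_sqrt M = M"
    unfolding psd_sqrt_def by blast+
qed

lemma pos_def_imp_pos_semidef: "pos_def M \<Longrightarrow> pos_semidef M"
  unfolding pos_def_def pos_semidef_def by (metis inner_zero_left less_imp_le order_refl)

lemma pos_def_invertible:
  assumes "pos_def M"
  shows "invertible M"
proof -
  have "\<forall>x. M *v x = 0 \<longrightarrow> x = 0"
    using assms unfolding pos_def_def by (metis inner_zero_right less_irrefl)
  then show ?thesis
    using matrix_left_invertible_ker[of M] invertible_left_inverse by blast
qed

subsection \<open>Characteristic polynomials\<close>

text \<open>With the eigenvectors as columns of \<open>W\<close> one has (z - A) W = W D, where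
  \<open>D\<close> is diagonal and \<open>W\<close> is invertible.\<close>

lemma det_mat_minus_eigenbasis:
  fixes A :: "complex^'m^'m"
  assumes u: "is_basis CARD('m) u"
    and eig: "\<And>j. j \<in> {1..CARD('m)} \<Longrightarrow> A *v u j = \<mu> j *s u j"
  shows "det (mat z - A) = (\<Prod>j\<in>{1..CARD('m)}. z - \<mu> j)"
proof -
  \<comment> \<open>The index type carries no numbering, so the numbered eigenpairs are transported
    to it along an arbitrary bijection.\<close>
  obtain h where h: "bij_betw h (UNIV :: 'm set) {1..CARD('m)}"
    using finite_same_card_bij[of "UNIV :: 'm set" "{1..CARD('m)}"] by auto
  define W where "W = (\<chi> i k. u (h k) $ i)"
  define D where "D = (\<chi> i k. if i = k then z - \<mu> (h k) else 0)"
  have "columns W = u ` range h"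
    by (auto simp: columns_def column_def W_def)
  then have "columns W = u ` {1..CARD('m)}"
    using bij_betw_imp_surj_on[OF h] by simp
  then have "invertible W"
    using u by (simp add: is_basis_def invertible_right_inverse matrix_right_invertible_span_columns)
  then have W: "det W \<noteq> 0"
    by (simp add: invertible_det_nz)
  have "((mat z - A) ** W) $ i $ k = (W ** D) $ i $ k" for i k
  proof -
    have "h k \<in> {1..CARD('m)}"
      using h by (auto simp: bij_betw_def)
    from eig[OF this] have "(A ** W) $ i $ k = \<mu> (h k) * u (h k) $ i"
      by (simp add: vec_eq_iff matrix_vector_mult_def matrix_matrix_mult_def W_def)
    moreover have "(W ** D) $ i $ k = (z - \<mu> (h k)) * u (h k) $ i"
      by (simp add: matrix_matrix_mult_def W_def D_def if_distrib sum.delta' mult.commute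
          cong: if_cong)
    moreover have "(mat z ** W) $ i $ k = z * u (h k) $ i"
      by (simp add: mat_mult W_def)
    ultimately show ?thesis
      by (simp add: matrix_diff_rdistrib left_diff_distrib)
  qed
  then have "(mat z - A) ** W = W ** D"
    by (simp add: vec_eq_iff)
  then have "det (mat z - A) * det W = det D * det W"
    by (metis det_mul mult.commute)
  moreover have "det D = (\<Prod>k\<in>UNIV. z - \<mu> (h k))"
    by (subst det_diagonal) (simp_all add: D_def)
  moreover have "\<dots> = (\<Prod>j\<in>{1..CARD('m)}. z - \<mu> j)"
    by (rule prod.reindex_bij_betw[OF h])
  ultimately show ?thesis
    using W by simp
qed

lemma poly_charpoly: "poly (charpoly M) x = det (mat x - M)"
proof -
  have "poly (mat [:0, 1:] $ i $ j - map_matrix (\<lambda>x. [:x:]) M $ i $ j) x = (mat x - M) $ i $ j" for i j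
    by (simp add: mat_def)
  then show ?thesis
    by (simp add: charpoly_def det_def poly_sum poly_prod)
qed

lemma tendsto_det:
  fixes f :: "'a \<Rightarrow> ('b::real_normed_field)^'n^'n"
  assumes "\<And>i j. ((\<lambda>x. f x $ i $ j) \<longlongrightarrow> L $ i $ j) F"
  shows "((\<lambda>x. det (f x)) \<longlongrightarrow> det L) F"
  unfolding det_def by (intro tendsto_sum tendsto_mult tendsto_prod tendsto_const assms)

lemma order_prod:
  assumes "finite I" "\<And>i. i \<in> I \<Longrightarrow> f i \<noteq> 0"
  shows "order a (\<Prod>i\<in>I. f i) = (\<Sum>i\<in>I. order a (f i))"
  using assms
proof (induction I rule: finite_induct)
  case empty
  then show ?case by (simp add: order_0I)
next
  case (insert i I)
  then have "f i * (\<Prod>i\<in>I. f i) \<noteq> 0"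
    by simp
  with insert show ?case
    by (simp add: order_mult)
qed

text \<open>\<open>[:-1, d i:]\<close> is the polynomial d_i x - 1, whose only root is 1 / d_i. Up
  to factors of x and \<i>, the substitution s = -\<i> / x brings s + \<i> d_i into this
  shape.\<close>

lemma order_prod_linear:
  fixes d :: "'i \<Rightarrow> complex"
  assumes "finite I" "\<And>i. i \<in> I \<Longrightarrow> d i \<noteq> 0"
  shows "order a (\<Prod>i\<in>I. [:-1, d i:]) = card {i\<in>I. 1 / d i = a}"
proof -
  have "order a [:-1, d i:] = (if 1 / d i = a then 1 else 0)" if "i \<in> I" for i
  proof -
    have "[:-1, d i:] = smult (d i) [:-(1 / d i), 1:]"
      using assms(2)[OF that] by simp
    then have "order a [:-1, d i:] = order a ([:-(1 / d i), 1:])"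
      using assms(2)[OF that] order_smult by metis
    moreover have "order a [:- a, 1:] = 1"
      using order_power_n_n[of a 1] by simp
    moreover have "1 / d i \<noteq> a \<Longrightarrow> order a [:-(1 / d i), 1:] = 0"
      by (rule order_0I) simp
    ultimately show ?thesis
      by auto
  qed
  then have "order a (\<Prod>i\<in>I. [:-1, d i:]) = (\<Sum>i\<in>I. if 1 / d i = a then 1 else 0)"
    using assms(1) by (subst order_prod) simp_all
  also have "\<dots> = card {i\<in>I. 1 / d i = a}"
    using assms(1) by (simp flip: sum.inter_filter)
  finally show ?thesis .
qed

subsection \<open>Limits and fibers\<close>

text \<open>Serves to discard an error term after rescaling by a weight \<open>h\<close>, which may
  itself be unbounded.\<close>

lemma bigo_tendsto_0:
  fixes f g h :: "'a \<Rightarrow> 'b::real_normed_field"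
  assumes "f \<in> O[F](g)" "((\<lambda>x. h x * g x) \<longlongrightarrow> 0) F"
  shows "((\<lambda>x. h x * f x) \<longlongrightarrow> 0) F"
proof -
  have "(\<lambda>x. h x * f x) \<in> O[F](\<lambda>x. h x * g x)"
    using assms(1) by (intro landau_o.big.mult landau_o.big_refl)
  moreover have "(\<lambda>x. h x * g x) \<in> o[F](\<lambda>_. 1)"
    using assms(2) by (intro smalloI_tendsto) simp_all
  ultimately have "(\<lambda>x. h x * f x) \<in> o[F](\<lambda>_. 1)"
    by (rule landau_o.big_small_trans)
  then show ?thesis
    using smalloD_tendsto by fastforce
qed

text \<open>Bijections between the fibres over each value are glued into one. This converts an
  equality of multiplicities into a reindexing.\<close>

lemma bij_betw_fibers:
  assumes "finite A" "finite B" "\<And>z. card {a\<in>A. f a = z} = card {b\<in>B. g b = z}"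
  shows "\<exists>\<sigma>. bij_betw \<sigma> A B \<and> (\<forall>a\<in>A. g (\<sigma> a) = f a)"
proof -
  have "\<forall>z. \<exists>h. bij_betw h {a\<in>A. f a = z} {b\<in>B. g b = z}"
    using assms by (intro allI finite_same_card_bij) auto
  then obtain h where h: "\<And>z. bij_betw (h z) {a\<in>A. f a = z} {b\<in>B. g b = z}"
    by metis
  define \<sigma> where "\<sigma> a = h (f a) a" for a
  have \<sigma>: "\<sigma> a \<in> B \<and> g (\<sigma> a) = f a" if "a \<in> A" for a
    using bij_betw_apply[OF h[of "f a"]] that by (simp add: \<sigma>_def)
  have "inj_on \<sigma> A"
  proof (rule inj_onI)
    fix a a' assume a: "a \<in> A" "a' \<in> A" "\<sigma> a = \<sigma> a'"
    then have "f a = f a'"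
      using \<sigma> by metis
    with a show "a = a'"
      using inj_onD[OF bij_betw_imp_inj_on[OF h[of "f a"]], of a a'] by (simp add: \<sigma>_def)
  qed
  moreover have "\<sigma> ` A = B"
  proof
    show "B \<subseteq> \<sigma> ` A"
    proof
      fix b assume "b \<in> B"
      then have "b \<in> h (g b) ` {a\<in>A. f a = g b}"
        using bij_betw_imp_surj_on[OF h[of "g b"]] by simp
      then obtain a where "a \<in> A" "f a = g b" "b = h (g b) a"
        by blast
      then show "b \<in> \<sigma> ` A"
        by (intro image_eqI[of _ _ a]) (simp_all add: \<sigma>_def)
    qed
  qed (use \<sigma> in auto)
  ultimately show ?thesis
    using \<sigma> by (auto simp: bij_betw_def)
qed

text \<open>Sorting by \<open>f\<close> supplies the monotone enumeration that
  \<open>nonzero_eigenvalues\<close> asks for.\<close>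

lemma sorting_bij_betw:
  fixes f :: "'a \<Rightarrow> 'b::linorder"
  assumes "finite A"
  shows "\<exists>\<tau>. bij_betw \<tau> {1..card A} A \<and> mono_on {1..card A} (f \<circ> \<tau>)"
proof -
  obtain ys where ys: "set ys = A" "distinct ys"
    using finite_distinct_list[OF assms] by blast
  define xs where "xs = sort_key f ys"
  have xs: "set xs = A" "distinct xs" "sorted (map f xs)" "length xs = card A"
    using ys distinct_card[of ys] by (auto simp: xs_def)
  \<comment> \<open>Positions in a list start at 0, the enumeration at 1.\<close>
  have "bij_betw (\<lambda>j. j - 1) {1..card A} {..<card A}"
    by (rule bij_betw_byWitness[where f' = Suc]) auto
  moreover have "bij_betw ((!) xs) {..<card A} A"
    using xs by (intro bij_betw_nth) auto
  ultimately have "bij_betw ((!) xs \<circ> (\<lambda>j. j - 1)) {1..card A} A"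
    by (rule bij_betw_trans)
  moreover have "mono_on {1..card A} (f \<circ> ((!) xs \<circ> (\<lambda>j. j - 1)))"
  proof (rule mono_onI)
    fix i j assume "i \<in> {1..card A}" "j \<in> {1..card A}" "i \<le> j"
    then show "(f \<circ> ((!) xs \<circ> (\<lambda>j. j - 1))) i \<le> (f \<circ> ((!) xs \<circ> (\<lambda>j. j - 1))) j"
      using sorted_nth_mono[OF xs(3), of "i - 1" "j - 1"] xs(4) by auto
  qed
  ultimately show ?thesis
    by blast
qed

subsection \<open>The quadratic pencil\<close>

lemma matrix_inv:
  assumes "invertible A"
  shows "matrix_inv A ** A = mat 1" "A ** matrix_inv A = mat 1"
proof -
  have "A ** matrix_inv A = mat 1 \<and> matrix_inv A ** A = mat 1"
    using assms unfolding invertible_def matrix_inv_def by (rule someI_ex)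
  then show "matrix_inv A ** A = mat 1" "A ** matrix_inv A = mat 1"
    by simp_all
qed

lemma cmat_mult: "cmat (A ** B) = cmat A ** cmat B"
  by (simp add: vec_eq_iff matrix_matrix_mult_def)

lemma cmat_mat_one: "cmat (mat 1) = mat 1"
  by (simp add: vec_eq_iff mat_def)

lemma det_cmat: "det (cmat A) = complex_of_real (det A)"
  by (simp add: det_def)

lemma scale_mat_mult_left: "scale_mat c A ** B = scale_mat c (A ** B)"
  by (simp add: vec_eq_iff matrix_matrix_mult_def sum_distrib_left mult_ac)

lemma scale_mat_mult_right: "A ** scale_mat c B = scale_mat c (A ** B)"
  by (simp add: vec_eq_iff matrix_matrix_mult_def sum_distrib_left mult_ac)

lemma scale_mat_scale_mat: "scale_mat c (scale_mat d A) = scale_mat (c * d) A"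
  by (simp add: vec_eq_iff mult_ac)

lemma mat_mult_eq_scale_mat: "mat c ** A = scale_mat c A"
  by (simp add: mat_mult vec_eq_iff)

lemma det_scale_mat: "det (scale_mat c A) = c ^ CARD('n) * det A" for A :: "complex^'n^'n"
  by (simp add: det_mul det_mat flip: mat_mult_eq_scale_mat)

text \<open>
  Eliminating the second component of an eigenvector turns \<open>A(\<beta>)\<close> into a quadratic pencil, from
  which the square roots disappear after multiplication by \<open>det \<alpha>\<close>.
\<close>

lemma det_mat_minus_system_op:
  fixes \<alpha> \<eta> \<theta> R :: "real^'n^'n"
  assumes \<alpha>: "pos_def \<alpha>" and \<eta>: "pos_semidef \<eta>" and z: "z \<noteq> 0"
  shows "det (cmat \<alpha>) * det (mat z - system_op (Omega_op \<alpha> \<eta> \<theta>) (B_op \<alpha> R) \<beta>) =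
    det (scale_mat (z\<^sup>2) (cmat \<alpha>) + scale_mat (2 * \<i> * z) (cmat \<theta>)
      + scale_mat (\<i> * of_real \<beta> * z) (cmat R) - cmat \<eta>)"
proof -
  define S J T where "S = psd_sqrt \<alpha>" and "J = matrix_inv S" and "T = psd_sqrt \<eta>"
  have S: "transpose S = S" "S ** S = \<alpha>"
    using psd_sqrt[OF pos_def_imp_pos_semidef[OF \<alpha>]] by (auto simp: S_def pos_semidef_def)
  have T: "transpose T = T" "T ** T = \<eta>"
    using psd_sqrt[OF \<eta>] by (auto simp: T_def pos_semidef_def)
  have "invertible S"
    using pos_def_invertible[OF \<alpha>] S(2) by (metis det_mul invertible_det_nz mult_eq_0_iff)
  then have J: "J ** S = mat 1" "S ** J = mat 1"
    by (simp_all add: J_def matrix_inv)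
  have JT: "transpose J = J"
  proof -
    have "S ** transpose J = mat 1"
      using J(1) S(1) by (metis matrix_transpose_mul transpose_mat)
    then have "J ** (S ** transpose J) = J"
      by simp
    then show ?thesis
      by (simp add: matrix_mul_assoc J)
  qed
  let ?S = "cmat S" and ?J = "cmat J" and ?T = "cmat T"
  have cJ: "?J ** ?S = mat 1" "?S ** ?J = mat 1"
    by (simp_all add: J cmat_mat_one flip: cmat_mult)
  \<comment> \<open>\<open>P\<close> is the upper left block of z - A(\<beta>), and \<open>X\<close>
    is the Schur complement already multiplied by \<open>z\<close>.\<close>
  define P where "P = mat z + scale_mat (2 * \<i>) (?J ** cmat \<theta> ** ?J)
    + scale_mat (\<i> * of_real \<beta>) (?J ** cmat R ** ?J)"
  define X where "X = mat z ** P - scale_mat \<i> (?J ** ?T) ** scale_mat (- \<i>) (?T ** ?J)"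
  have "mat z - system_op (Omega_op \<alpha> \<eta> \<theta>) (B_op \<alpha> R) \<beta> =
    block_mat P (scale_mat \<i> (?J ** ?T)) (scale_mat (- \<i>) (?T ** ?J)) (mat z)"
    by (auto simp: vec_eq_iff system_op_def Omega_op_def B_op_def block_mat_def mat_def P_def
        Phi_def matrix_transpose_mul T JT cmat_mult
        simp flip: S_def T_def J_def split: sum.splits)
  then have det_X: "det (mat z - system_op (Omega_op \<alpha> \<eta> \<theta>) (B_op \<alpha> R) \<beta>) = det X"
    using z by (simp add: det_block_mat_scalar X_def)
  have X: "X = scale_mat (z\<^sup>2) (mat 1) + scale_mat (2 * \<i> * z) (?J ** cmat \<theta> ** ?J)
    + scale_mat (\<i> * of_real \<beta> * z) (?J ** cmat R ** ?J) - ?J ** cmat \<eta> ** ?J"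
  proof -
    have "?J ** ?T ** (?T ** ?J) = ?J ** cmat \<eta> ** ?J"
      by (simp add: cmat_mult matrix_mul_assoc flip: T(2))
    \<comment> \<open>The factors \<i> and -\<i> multiply to 1, and the two copies of the root of
      \<eta> meet.\<close>
    then have "scale_mat \<i> (?J ** ?T) ** scale_mat (- \<i>) (?T ** ?J) = ?J ** cmat \<eta> ** ?J"
      by (simp add: scale_mat_mult_left scale_mat_mult_right scale_mat_scale_mat)
        (simp add: vec_eq_iff)
    then show ?thesis
      unfolding X_def P_def mat_mult_eq_scale_mat
      by (auto simp: vec_eq_iff mat_def power2_eq_square algebra_simps)
  qed
  have conj: "?S ** (?J ** M ** ?J) ** ?S = M" for M
  proof -
    have "?S ** (?J ** M ** ?J) ** ?S = (?S ** ?J) ** M ** (?J ** ?S)"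
      by (simp only: matrix_mul_assoc)
    then show ?thesis
      by (simp add: cJ)
  qed
  \<comment> \<open>Multiplying by \<open>S\<close> on both sides cancels every \<open>J\<close>,
    turns the identity into \<alpha>, and multiplies the determinant by det \<alpha>.\<close>
  have "?S ** X ** ?S = scale_mat (z\<^sup>2) (?S ** ?S) + scale_mat (2 * \<i> * z) (cmat \<theta>)
      + scale_mat (\<i> * of_real \<beta> * z) (cmat R) - cmat \<eta>"
    unfolding X
    by (simp add: matrix_add_ldistrib matrix_diff_ldistrib matrix_diff_rdistrib matrix_add_rdistrib
        scale_mat_mult_left scale_mat_mult_right conj)
  moreover have "det (?S ** X ** ?S) = det (cmat \<alpha>) * det X"
    by (simp add: det_mul cmat_mult flip: S(2))
  moreover have "?S ** ?S = cmat \<alpha>"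
    by (simp add: S flip: cmat_mult)
  ultimately show ?thesis
    by (simp add: det_X)
qed

section \<open>The large-loss limit at the scale z = s / \<beta>\<close>

text \<open>The high-loss factors converge after division by \<beta>, the factors with indices from
  k + 1 to 2k after multiplication by \<beta>, and the others as they stand. Both rescaled groups
  have \<open>k\<close> members, so the scalings cancel in the product.\<close>

lemma prod_eigenvalues_limit:
  fixes \<zeta> :: "nat \<Rightarrow> real \<Rightarrow> complex" and b \<rho> d :: "nat \<Rightarrow> real"
  assumes n: "2 * k \<le> n"
    and high: "\<And>j. j \<in> {1..k} \<Longrightarrow>
      (\<lambda>\<beta>. \<zeta> j \<beta> - (- \<i> * of_real (b j * \<beta>) + of_real (\<rho> j))) \<in> O[at_top](\<lambda>\<beta>. of_real (1 / \<beta>))"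
    and low: "\<And>j. j \<in> {k+1..n} \<Longrightarrow>
      (\<lambda>\<beta>. \<zeta> j \<beta> - (of_real (\<rho> j) - \<i> * of_real (d j / \<beta>))) \<in> O[at_top](\<lambda>\<beta>. of_real (1 / \<beta>\<^sup>2))"
    and zero: "\<And>j. j \<in> {k+1..2*k} \<Longrightarrow> \<rho> j = 0"
  shows "((\<lambda>\<beta>. \<Prod>j\<in>{1..n}. s / of_real \<beta> - \<zeta> j \<beta>) \<longlongrightarrow>
    (\<Prod>j\<in>{1..k}. \<i> * of_real (b j)) * (\<Prod>j\<in>{k+1..2*k}. s + \<i> * of_real (d j)) *
    (\<Prod>j\<in>{2*k+1..n}. - of_real (\<rho> j))) at_top"
proof -
  define e where "e \<beta> = complex_of_real (1 / \<beta>)" for \<beta>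
  have pos: "\<forall>\<^sub>F \<beta> in at_top. (0::real) < \<beta>"
    by (rule eventually_gt_at_top)
  have "((\<lambda>\<beta>::real. 1 / \<beta>) \<longlongrightarrow> 0) at_top"
    using tendsto_inverse_0_at_top[OF filterlim_ident] by (simp add: inverse_eq_divide)
  then have e: "(e \<longlongrightarrow> 0) at_top"
    unfolding e_def using tendsto_of_real[where 'a = complex and a = 0] by (simp del: of_real_divide)
  have "((\<lambda>\<beta>. e \<beta> * (s / of_real \<beta> - \<zeta> j \<beta>)) \<longlongrightarrow> \<i> * of_real (b j)) at_top"
    if "j \<in> {1..k}" for j
  proof -
    define f where "f \<beta> = \<zeta> j \<beta> - (- \<i> * of_real (b j * \<beta>) + of_real (\<rho> j))" for \<beta>
    have "((\<lambda>\<beta>. e \<beta> * f \<beta>) \<longlongrightarrow> 0) at_top"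
      using high[OF that] tendsto_mult[OF e e] unfolding f_def[symmetric] e_def[symmetric]
      by (intro bigo_tendsto_0[of f at_top e]) simp_all
    then have "((\<lambda>\<beta>. s * e \<beta> * e \<beta> - e \<beta> * f \<beta> + \<i> * of_real (b j) - e \<beta> * of_real (\<rho> j)) \<longlongrightarrow>
        s * 0 * 0 - 0 + \<i> * of_real (b j) - 0 * of_real (\<rho> j)) at_top"
      by (intro tendsto_intros e)
    moreover have "\<forall>\<^sub>F \<beta> in at_top. s * e \<beta> * e \<beta> - e \<beta> * f \<beta> + \<i> * of_real (b j) - e \<beta> * of_real (\<rho> j)
        = e \<beta> * (s / of_real \<beta> - \<zeta> j \<beta>)"
      using pos by eventually_elim (simp add: e_def f_def field_simps)
    ultimately show ?thesis
      using Lim_transform_eventually by fastforce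
  qed
  then have high_lim: "((\<lambda>\<beta>. \<Prod>j\<in>{1..k}. e \<beta> * (s / of_real \<beta> - \<zeta> j \<beta>)) \<longlongrightarrow>
      (\<Prod>j\<in>{1..k}. \<i> * of_real (b j))) at_top"
    by (rule tendsto_prod)
  have "((\<lambda>\<beta>. of_real \<beta> * (s / of_real \<beta> - \<zeta> j \<beta>)) \<longlongrightarrow> s + \<i> * of_real (d j)) at_top"
    if "j \<in> {k+1..2*k}" for j
  proof -
    define f where "f \<beta> = \<zeta> j \<beta> - (of_real (\<rho> j) - \<i> * of_real (d j / \<beta>))" for \<beta>
    \<comment> \<open>The error is O(1 / \<beta>^2), so after multiplication by \<beta> it is still
      O(1 / \<beta>).\<close>
    have "\<forall>\<^sub>F \<beta> in at_top. e \<beta> = of_real \<beta> * of_real (1 / \<beta>\<^sup>2)"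
      using pos by eventually_elim (simp add: e_def power2_eq_square)
    with e have "((\<lambda>\<beta>. complex_of_real \<beta> * of_real (1 / \<beta>\<^sup>2)) \<longlongrightarrow> 0) at_top"
      by (rule Lim_transform_eventually)
    then have "((\<lambda>\<beta>. of_real \<beta> * f \<beta>) \<longlongrightarrow> 0) at_top"
      using low[of j] that n unfolding f_def[symmetric]
      by (intro bigo_tendsto_0[of f at_top "\<lambda>\<beta>. of_real (1 / \<beta>\<^sup>2)"]) simp_all
    then have "((\<lambda>\<beta>. s - of_real \<beta> * f \<beta> + \<i> * of_real (d j)) \<longlongrightarrow> s - 0 + \<i> * of_real (d j)) at_top"
      by (intro tendsto_intros)
    \<comment> \<open>Here \<open>\<rho> j = 0\<close> removes the term \<beta> \<rho>_j, which
      would otherwise diverge.\<close>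
    moreover have "\<forall>\<^sub>F \<beta> in at_top. s - of_real \<beta> * f \<beta> + \<i> * of_real (d j)
        = of_real \<beta> * (s / of_real \<beta> - \<zeta> j \<beta>)"
      using pos by eventually_elim (simp add: f_def zero[OF that] field_simps)
    ultimately show ?thesis
      using Lim_transform_eventually by fastforce
  qed
  then have zero_lim: "((\<lambda>\<beta>. \<Prod>j\<in>{k+1..2*k}. of_real \<beta> * (s / of_real \<beta> - \<zeta> j \<beta>)) \<longlongrightarrow>
      (\<Prod>j\<in>{k+1..2*k}. s + \<i> * of_real (d j))) at_top"
    by (rule tendsto_prod)
  have "((\<lambda>\<beta>. s / of_real \<beta> - \<zeta> j \<beta>) \<longlongrightarrow> - of_real (\<rho> j)) at_top"
    if "j \<in> {2*k+1..n}" for j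
  proof -
    define f where "f \<beta> = \<zeta> j \<beta> - (of_real (\<rho> j) - \<i> * of_real (d j / \<beta>))" for \<beta>
    have "((\<lambda>\<beta>. 1 * complex_of_real (1 / \<beta>\<^sup>2)) \<longlongrightarrow> 0) at_top"
      using tendsto_mult[OF e e] by (simp add: e_def power2_eq_square)
    then have "((\<lambda>\<beta>. 1 * f \<beta>) \<longlongrightarrow> 0) at_top"
      using low[of j] that unfolding f_def[symmetric]
      by (intro bigo_tendsto_0[of f at_top "\<lambda>\<beta>. of_real (1 / \<beta>\<^sup>2)"]) simp_all
    then have "((\<lambda>\<beta>. s * e \<beta> - 1 * f \<beta> - of_real (\<rho> j) + \<i> * of_real (d j) * e \<beta>) \<longlongrightarrow>
        s * 0 - 0 - of_real (\<rho> j) + \<i> * of_real (d j) * 0) at_top"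
      by (intro tendsto_intros e)
    then show ?thesis
      by (simp add: f_def e_def)
  qed
  then have rest_lim: "((\<lambda>\<beta>. \<Prod>j\<in>{2*k+1..n}. s / of_real \<beta> - \<zeta> j \<beta>) \<longlongrightarrow>
      (\<Prod>j\<in>{2*k+1..n}. - of_real (\<rho> j))) at_top"
    by (rule tendsto_prod)
  have split: "(\<Prod>j\<in>{1..n}. g j) = (\<Prod>j\<in>{1..k}. g j) * (\<Prod>j\<in>{k+1..2*k}. g j) * (\<Prod>j\<in>{2*k+1..n}. g j)"
    for g :: "nat \<Rightarrow> complex"
    using prod.ub_add_nat[of 1 k g k] prod.ub_add_nat[of 1 "2*k" g "n - 2*k"] n
    by (simp add: mult_2)
  have "\<forall>\<^sub>F \<beta> in at_top. (\<Prod>j\<in>{1..k}. e \<beta> * (s / of_real \<beta> - \<zeta> j \<beta>)) *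
      (\<Prod>j\<in>{k+1..2*k}. of_real \<beta> * (s / of_real \<beta> - \<zeta> j \<beta>)) *
      (\<Prod>j\<in>{2*k+1..n}. s / of_real \<beta> - \<zeta> j \<beta>) = (\<Prod>j\<in>{1..n}. s / of_real \<beta> - \<zeta> j \<beta>)"
    using pos
  proof eventually_elim
    case (elim \<beta>)
    then have "e \<beta> ^ k * of_real \<beta> ^ k = 1"
      by (simp add: e_def flip: power_mult_distrib)
    moreover have "(\<Prod>j\<in>{1..k}. e \<beta> * (s / of_real \<beta> - \<zeta> j \<beta>)) *
        (\<Prod>j\<in>{k+1..2*k}. of_real \<beta> * (s / of_real \<beta> - \<zeta> j \<beta>)) *
        (\<Prod>j\<in>{2*k+1..n}. s / of_real \<beta> - \<zeta> j \<beta>) =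
        e \<beta> ^ k * of_real \<beta> ^ k * (\<Prod>j\<in>{1..n}. s / of_real \<beta> - \<zeta> j \<beta>)"
      unfolding split by (simp add: prod.distrib)
    ultimately show ?case
      by simp
  qed
  then show ?thesis
    by (rule Lim_transform_eventually[OF tendsto_mult[OF tendsto_mult[OF high_lim zero_lim] rest_lim]])
qed

section \<open>From the pencil to the spectrum of \<eta>^-1 R\<close>

text \<open>For s = -\<i> / x the pencil is R / x - \<eta> = -\<eta> (x - \<eta>^-1 R) / x. Hence
  the characteristic polynomial and the product of the d_i x - 1 agree up to a nonzero constant and
  powers of x, which do not affect the order at \<open>z \<noteq> 0\<close>.\<close>

lemma order_charpoly_from_pencil:
  fixes R \<eta> :: "real^'n^'n" and d :: "'i \<Rightarrow> real"
  assumes \<eta>: "invertible \<eta>" and I: "finite I" "I \<noteq> {}" and C: "C \<noteq> 0"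
    and d: "\<And>i. i \<in> I \<Longrightarrow> d i \<noteq> 0"
    and pencil: "\<And>s. s \<noteq> 0 \<Longrightarrow>
      det (scale_mat (\<i> * s) (cmat R) - cmat \<eta>) = C * (\<Prod>i\<in>I. s + \<i> * of_real (d i))"
    and z: "z \<noteq> 0"
  shows "order z (charpoly (cmat (matrix_inv \<eta> ** R))) = card {i\<in>I. of_real (1 / d i) = z}"
proof -
  let ?N = "CARD('n)" and ?k = "card I"
  define p where "p = charpoly (cmat (matrix_inv \<eta> ** R))"
  define q where "q = (\<Prod>i\<in>I. [:-1, complex_of_real (d i):])"
  \<comment> \<open>\<open>K\<close> collects the sign of (-x)^N, the constant \<open>C\<close>, and
    one factor \<i> from each x (s + \<i> d_i) = \<i> (d_i x - 1).\<close>
  define K where "K = (- 1) ^ ?N * C * \<i> ^ ?k"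
  have det\<eta>: "det (cmat \<eta>) \<noteq> 0"
    using \<eta> by (simp add: det_cmat invertible_det_nz)
  \<comment> \<open>The factor \<open>x ^ ?k\<close> clears the denominators of the product over
    \<open>I\<close>.\<close>
  have eq: "det (cmat \<eta>) * (x ^ ?k * poly p x) = K * (x ^ ?N * poly q x)" if x: "x \<noteq> 0" for x
  proof -
    let ?s = "- \<i> / x"
    have "cmat \<eta> ** (mat x - cmat (matrix_inv \<eta> ** R)) = scale_mat x (cmat \<eta>) - cmat R"
      by (simp add: matrix_diff_ldistrib matrix_mul_assoc matrix_inv(2)[OF \<eta>]
          mat_mult_commute[symmetric] mat_mult_eq_scale_mat flip: cmat_mult)
    also have "\<dots> = scale_mat (- x) (scale_mat (\<i> * ?s) (cmat R) - cmat \<eta>)"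
      using x by (simp add: vec_eq_iff field_simps)
    finally have "det (cmat \<eta>) * poly p x = (- x) ^ ?N * det (scale_mat (\<i> * ?s) (cmat R) - cmat \<eta>)"
      unfolding p_def poly_charpoly by (metis det_mul det_scale_mat)
    also have "\<dots> = (- x) ^ ?N * (C * (\<Prod>i\<in>I. ?s + \<i> * of_real (d i)))"
      using x by (subst pencil) simp_all
    also have "x ^ ?k * \<dots> = (- x) ^ ?N * C * (\<Prod>i\<in>I. x * (?s + \<i> * of_real (d i)))"
      by (simp add: prod.distrib)
    also have "(\<Prod>i\<in>I. x * (?s + \<i> * of_real (d i))) = (\<Prod>i\<in>I. \<i> * (of_real (d i) * x - 1))"
      using x by (intro prod.cong refl) (simp add: field_simps)
    also have "\<dots> = \<i> ^ ?k * poly q x"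
      by (simp add: q_def poly_prod prod.distrib mult.commute)
    finally show ?thesis
      by (simp add: K_def power_minus[of x] mult_ac)
  qed
  have k: "?k > 0"
    using I by (simp add: card_gt_0_iff)
  \<comment> \<open>The identity extends to \<open>x = 0\<close>, where both sides vanish:
    \<open>?k\<close> is positive since \<open>I\<close> is nonempty, and \<open>?N\<close> is
    positive as the cardinality of a type.\<close>
  have "poly (smult (det (cmat \<eta>)) (monom 1 ?k * p)) x = poly (smult K (monom 1 ?N * q)) x" for x
    using eq[of x] k by (cases "x = 0") (simp_all add: poly_monom power_0_left)
  then have poly_eq: "smult (det (cmat \<eta>)) (monom 1 ?k * p) = smult K (monom 1 ?N * q)"
    by (simp add: poly_eq_poly_eq_iff[symmetric] fun_eq_iff)
  have K: "K \<noteq> 0"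
    using C by (simp add: K_def)
  have q: "q \<noteq> 0"
    using I d by (simp add: q_def)
  have monom: "order z (monom 1 n) = 0" for n
    using z by (intro order_0I) (simp add: poly_monom)
  have "monom 1 ?N * q \<noteq> 0"
    using q by simp
  then have nz: "monom 1 ?k * p \<noteq> 0"
    using poly_eq K by (metis smult_0_right smult_eq_0_iff)
  have "order z p = order z (monom 1 ?k * p)"
    using nz by (simp add: order_mult monom)
  also have "\<dots> = order z (smult K (monom 1 ?N * q))"
    using det\<eta> by (simp add: order_smult flip: poly_eq)
  also have "\<dots> = order z q"
    using K \<open>monom 1 ?N * q \<noteq> 0\<close> by (simp add: order_smult order_mult monom)
  also have "\<dots> = card {i\<in>I. 1 / complex_of_real (d i) = z}"
    unfolding q_def using I d by (intro order_prod_linear) simp_all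
  finally show ?thesis
    by (simp add: p_def)
qed

lemma eigenpair_asymptoticsD:
  fixes \<Omega> B :: "complex^'m^'m"
  assumes "eigenpair_asymptotics \<Omega> B k b w0 \<rho> d \<zeta> w"
  shows "nonzero_eigenvalues B k b"
    and "\<forall>\<^sub>F \<beta> in at_top. is_basis CARD('m) (\<lambda>j. w j \<beta>) \<and>
      (\<forall>j\<in>{1..CARD('m)}. system_op \<Omega> B \<beta> *v w j \<beta> = \<zeta> j \<beta> *s w j \<beta>)"
    and "j \<in> {1..k} \<Longrightarrow>
      (\<lambda>\<beta>. \<zeta> j \<beta> - (- \<i> * of_real (b j * \<beta>) + of_real (\<rho> j))) \<in> O[at_top](\<lambda>\<beta>. of_real (1 / \<beta>))"
    and "j \<in> {k+1..CARD('m)} \<Longrightarrow> 0 \<le> d j"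
    and "j \<in> {k+1..CARD('m)} \<Longrightarrow>
      (\<lambda>\<beta>. \<zeta> j \<beta> - (of_real (\<rho> j) - \<i> * of_real (d j / \<beta>))) \<in> O[at_top](\<lambda>\<beta>. of_real (1 / \<beta>\<^sup>2))"
  using assms unfolding eigenpair_asymptotics_def
  by - ((elim conjE, assumption) | (elim conjE, drule(1) bspec, elim conjE, assumption))+

text \<open>Both expressions for the determinant at z = s / \<beta> have limits as \<beta> grows,
  and limits are unique. In the pencil the terms with \<alpha> and \<theta> vanish, while \<i>
  \<beta> z R equals \<i> s R.\<close>

lemma pencil_factorization:
  fixes \<alpha> \<eta> \<theta> R :: "real^'n^'n"
    and b \<rho> d :: "nat \<Rightarrow> real"
    and w0 :: "nat \<Rightarrow> complex^('n + 'n)"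
    and \<zeta> :: "nat \<Rightarrow> real \<Rightarrow> complex"
    and w :: "nat \<Rightarrow> real \<Rightarrow> complex^('n + 'n)"
  assumes \<alpha>: "pos_def \<alpha>" and \<eta>: "pos_semidef \<eta>"
    and asym: "eigenpair_asymptotics (Omega_op \<alpha> \<eta> \<theta>) (B_op \<alpha> R) k b w0 \<rho> d \<zeta> w"
    and k: "k \<le> CARD('n)"
    and zero: "\<And>j. j \<in> {k + 1..2 * CARD('n)} \<Longrightarrow> \<rho> j = 0 \<longleftrightarrow> j \<le> 2 * k"
  obtains C where "C \<noteq> 0"
    and "\<And>s. s \<noteq> 0 \<Longrightarrow> det (scale_mat (\<i> * s) (cmat R) - cmat \<eta>) =
      C * (\<Prod>j\<in>{k+1..2*k}. s + \<i> * of_real (d j))"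
proof -
  let ?A = "system_op (Omega_op \<alpha> \<eta> \<theta>) (B_op \<alpha> R)"
  have card: "CARD('n + 'n) = 2 * CARD('n)"
    by simp
  have b: "b j > 0" if "j \<in> {1..k}" for j
    using eigenpair_asymptoticsD(1)[OF asym] that by (simp add: nonzero_eigenvalues_def)
  have ev: "\<forall>\<^sub>F \<beta> in at_top. is_basis (2 * CARD('n)) (\<lambda>j. w j \<beta>) \<and>
      (\<forall>j\<in>{1..2 * CARD('n)}. ?A \<beta> *v w j \<beta> = \<zeta> j \<beta> *s w j \<beta>)"
    using eigenpair_asymptoticsD(2)[OF asym] unfolding card .
  have high: "(\<lambda>\<beta>. \<zeta> j \<beta> - (- \<i> * of_real (b j * \<beta>) + of_real (\<rho> j))) \<in> O[at_top](\<lambda>\<beta>. of_real (1 / \<beta>))"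
    if "j \<in> {1..k}" for j
    using eigenpair_asymptoticsD(3)[OF asym that] .
  have low: "(\<lambda>\<beta>. \<zeta> j \<beta> - (of_real (\<rho> j) - \<i> * of_real (d j / \<beta>))) \<in> O[at_top](\<lambda>\<beta>. of_real (1 / \<beta>\<^sup>2))"
    if "j \<in> {k+1..2 * CARD('n)}" for j
    using eigenpair_asymptoticsD(5)[OF asym, unfolded card, OF that] .
  \<comment> \<open>Besides det \<alpha>, this gathers the limits of the high-loss factors and of
    the low-loss factors with nonzero limit eigenvalue. The indexing places the latter at j > 2k, so
    \<open>C1\<close> does not vanish.\<close>
  define C1 where "C1 = det (cmat \<alpha>) * (\<Prod>j\<in>{1..k}. \<i> * of_real (b j)) *
    (\<Prod>j\<in>{2*k+1..2 * CARD('n)}. - of_real (\<rho> j))"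
  have "det (cmat \<alpha>) \<noteq> 0"
    using pos_def_invertible[OF \<alpha>] by (simp add: det_cmat invertible_det_nz)
  moreover have "\<rho> j \<noteq> 0" if "j \<in> {2*k+1..2 * CARD('n)}" for j
    using zero[of j] that by auto
  ultimately have C1: "C1 \<noteq> 0"
    using b by (auto simp: C1_def less_le)
  have fact: "det (scale_mat (\<i> * s) (cmat R) - cmat \<eta>) =
      C1 * (\<Prod>j\<in>{k+1..2*k}. s + \<i> * of_real (d j))" if s: "s \<noteq> 0" for s
  proof -
    let ?G = "\<lambda>\<beta>. scale_mat ((s / of_real \<beta>)\<^sup>2) (cmat \<alpha>)
      + scale_mat (2 * \<i> * (s / of_real \<beta>)) (cmat \<theta>)
      + scale_mat (\<i> * of_real \<beta> * (s / of_real \<beta>)) (cmat R) - cmat \<eta>"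
    have e: "((\<lambda>\<beta>. s / complex_of_real \<beta>) \<longlongrightarrow> 0) at_top"
      by (intro tendsto_divide_0[OF tendsto_const] filterlim_compose[OF filterlim_of_real_at_infinity]
          filterlim_at_top_imp_at_infinity filterlim_ident)
    have r: "((\<lambda>\<beta>. \<i> * of_real \<beta> * (s / of_real \<beta>)) \<longlongrightarrow> \<i> * s) at_top"
      by (rule Lim_transform_eventually[OF tendsto_const])
        (use eventually_gt_at_top[of 0] in \<open>eventually_elim, simp\<close>)
    have "((\<lambda>\<beta>. ?G \<beta> $ i $ j) \<longlongrightarrow> 0\<^sup>2 * cmat \<alpha> $ i $ j + 2 * \<i> * 0 * cmat \<theta> $ i $ j
        + \<i> * s * cmat R $ i $ j - cmat \<eta> $ i $ j) at_top" for i j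
      unfolding vector_add_component vector_minus_component nth_map_matrix[of "(*) _"]
      by (intro tendsto_intros e r)
    then have "((\<lambda>\<beta>. det (?G \<beta>)) \<longlongrightarrow> det (scale_mat (\<i> * s) (cmat R) - cmat \<eta>)) at_top"
      by (intro tendsto_det) simp
    moreover have "\<forall>\<^sub>F \<beta> in at_top. det (?G \<beta>) =
        det (cmat \<alpha>) * (\<Prod>j\<in>{1..2 * CARD('n)}. s / of_real \<beta> - \<zeta> j \<beta>)"
      using ev eventually_gt_at_top[of 0]
    proof eventually_elim
      case (elim \<beta>)
      then have "det (mat (s / of_real \<beta>) - ?A \<beta>) =
          (\<Prod>j\<in>{1..2 * CARD('n)}. s / of_real \<beta> - \<zeta> j \<beta>)"
        using det_mat_minus_eigenbasis[of "\<lambda>j. w j \<beta>" "?A \<beta>" "\<lambda>j. \<zeta> j \<beta>" "s / of_real \<beta>"]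
        unfolding card by blast
      \<comment> \<open>For \<open>s \<noteq> 0\<close> and \<beta> > 0 the point s / \<beta> is
        nonzero, as the elimination requires.\<close>
      then show ?case
        using det_mat_minus_system_op[OF \<alpha> \<eta>, of "s / of_real \<beta>" \<theta> R \<beta>] s elim by simp
    qed
    ultimately have "((\<lambda>\<beta>. det (cmat \<alpha>) * (\<Prod>j\<in>{1..2 * CARD('n)}. s / of_real \<beta> - \<zeta> j \<beta>)) \<longlongrightarrow>
        det (scale_mat (\<i> * s) (cmat R) - cmat \<eta>)) at_top"
      by (rule Lim_transform_eventually)
    moreover have "((\<lambda>\<beta>. det (cmat \<alpha>) * (\<Prod>j\<in>{1..2 * CARD('n)}. s / of_real \<beta> - \<zeta> j \<beta>)) \<longlongrightarrow>
        det (cmat \<alpha>) * ((\<Prod>j\<in>{1..k}. \<i> * of_real (b j)) * (\<Prod>j\<in>{k+1..2*k}. s + \<i> * of_real (d j)) *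
        (\<Prod>j\<in>{2*k+1..2 * CARD('n)}. - of_real (\<rho> j)))) at_top"
      using k zero by (intro tendsto_mult tendsto_const prod_eigenvalues_limit high low) auto
    ultimately have "det (scale_mat (\<i> * s) (cmat R) - cmat \<eta>) =
        det (cmat \<alpha>) * ((\<Prod>j\<in>{1..k}. \<i> * of_real (b j)) * (\<Prod>j\<in>{k+1..2*k}. s + \<i> * of_real (d j)) *
        (\<Prod>j\<in>{2*k+1..2 * CARD('n)}. - of_real (\<rho> j)))"
      by (rule tendsto_unique[OF trivial_limit_at_top_linorder])
    then show ?thesis
      by (simp only: C1_def mult_ac)
  qed
  show thesis
    by (rule that[OF C1 fact])
qed

section \<open>Matching the decay rates with the eigenvalues\<close>

theorem corollary39:
  fixes \<alpha> \<eta> \<theta> R :: "real^'n^'n"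
    and b \<rho> d :: "nat \<Rightarrow> real"
    and w0 :: "nat \<Rightarrow> complex^('n + 'n)"
    and \<zeta> :: "nat \<Rightarrow> real \<Rightarrow> complex"
    and w :: "nat \<Rightarrow> real \<Rightarrow> complex^('n + 'n)"
  assumes "pos_def \<alpha>"
    and "pos_semidef \<eta>"
    and "transpose \<theta> = - \<theta>"
    and "pos_semidef R"
    and "rank R > 0"
    and "eigenpair_asymptotics (Omega_op \<alpha> \<eta> \<theta>) (B_op \<alpha> R) (rank R) b w0 \<rho> d \<zeta> w"
    and duality: "pos_def \<eta>"
    and zero_indexing: "\<And>j. j \<in> {rank R + 1..2 * CARD('n)} \<Longrightarrow> \<rho> j = 0 \<longleftrightarrow> j \<le> 2 * rank R"
  shows "(\<exists>b_flat. nonzero_eigenvalues (cmat (matrix_inv \<eta> ** R)) (rank R) b_flat) \<and>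
    (\<forall>b_flat. nonzero_eigenvalues (cmat (matrix_inv \<eta> ** R)) (rank R) b_flat \<longrightarrow>
      (\<exists>\<sigma>. bij_betw \<sigma> {rank R + 1..2 * rank R} {rank R + 1..2 * rank R} \<and>
        (\<forall>j\<in>{rank R + 1..2 * rank R}.
          (\<lambda>\<beta>. \<zeta> (\<sigma> j) \<beta> - (- \<i> * complex_of_real (1 / b_flat (j - rank R) * (1 / \<beta>))))
            \<in> O[at_top](\<lambda>\<beta>. complex_of_real (1 / \<beta>\<^sup>2)))))"
proof -
  define k where "k = rank R"
  define I where "I = {k + 1..2 * k}"
  let ?M = "cmat (matrix_inv \<eta> ** R)"
  note asym = assms(6)[folded k_def]
  have k: "0 < k" "k \<le> CARD('n)"
    using assms(5) rank_bound[of R] by (simp_all add: k_def)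
  have I: "finite I" "I \<noteq> {}" "card I = k"
    using k by (auto simp: I_def)
  obtain C where C: "C \<noteq> 0"
    and pencil: "\<And>s. s \<noteq> 0 \<Longrightarrow> det (scale_mat (\<i> * s) (cmat R) - cmat \<eta>) =
      C * (\<Prod>j\<in>I. s + \<i> * of_real (d j))"
    using pencil_factorization[OF assms(1,2) asym k(2)] zero_indexing unfolding k_def I_def by blast
  have inv: "invertible \<eta>"
    by (rule pos_def_invertible[OF duality])
  \<comment> \<open>By continuity the factorization also holds at s = 0, where it equates det
    (-\<eta>) with \<open>C\<close> times the product of the \<i> d_j. The left side is nonzero by
    the duality condition, so no d_j vanishes; d_j \<ge> 0 is part of the asymptotics.\<close>
  have d: "d j > 0" if "j \<in> I" for j
  proof -
    have lim: "((\<lambda>s. det (scale_mat (\<i> * s) (cmat R) - cmat \<eta>)) \<longlongrightarrow> det (- cmat \<eta>)) (at 0)"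
    proof (rule tendsto_det)
      show "((\<lambda>s. (scale_mat (\<i> * s) (cmat R) - cmat \<eta>) $ i $ j) \<longlongrightarrow> (- cmat \<eta>) $ i $ j) (at 0)" for i j
        by (auto intro!: tendsto_eq_intros)
    qed
    have lim': "((\<lambda>s. C * (\<Prod>j\<in>I. s + \<i> * of_real (d j))) \<longlongrightarrow>
        C * (\<Prod>j\<in>I. 0 + \<i> * of_real (d j))) (at 0)"
      by (intro tendsto_intros)
    have ev: "\<forall>\<^sub>F s in at 0. det (scale_mat (\<i> * s) (cmat R) - cmat \<eta>) =
        C * (\<Prod>j\<in>I. s + \<i> * of_real (d j))"
      using pencil by (simp add: eventually_at_filter)
    have "det (- cmat \<eta>) = C * (\<Prod>j\<in>I. 0 + \<i> * of_real (d j))"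
      by (rule tendsto_unique[OF at_neq_bot Lim_transform_eventually[OF lim ev] lim'])
    moreover have "- cmat \<eta> = scale_mat (- 1) (cmat \<eta>)"
      by (simp add: vec_eq_iff)
    then have "det (- cmat \<eta>) \<noteq> 0"
      using inv by (simp add: det_scale_mat det_cmat invertible_det_nz)
    ultimately have "d j \<noteq> 0"
      using that I by auto
    moreover have "d j \<ge> 0"
      using eigenpair_asymptoticsD(4)[OF asym] that k by (simp add: I_def)
    ultimately show ?thesis
      by simp
  qed
  have d0: "d j \<noteq> 0" if "j \<in> I" for j
    using d[OF that] by simp
  have order: "order z (charpoly ?M) = card {j\<in>I. of_real (1 / d j) = z}" if "z \<noteq> 0" for z
    by (rule order_charpoly_from_pencil[OF inv I(1,2) C d0 pencil that])
  \<comment> \<open>The rates d_j come in no particular order; sorting their reciprocals yields the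
    required monotone list of eigenvalues.\<close>
  obtain \<tau> where \<tau>: "bij_betw \<tau> {1..k} I" "mono_on {1..k} ((\<lambda>j. 1 / d j) \<circ> \<tau>)"
    using sorting_bij_betw[OF I(1), of "\<lambda>j. 1 / d j"] I(3) by auto
  have ex: "nonzero_eigenvalues ?M k ((\<lambda>j. 1 / d j) \<circ> \<tau>)"
    unfolding nonzero_eigenvalues_def
  proof (intro conjI allI impI ballI)
    show "0 < ((\<lambda>j. 1 / d j) \<circ> \<tau>) j" if "j \<in> {1..k}" for j
      using d bij_betw_apply[OF \<tau>(1) that] by simp
    fix z :: complex assume z: "z \<noteq> 0"
    have "bij_betw \<tau> {j\<in>{1..k}. of_real (1 / d (\<tau> j)) = z} {j\<in>I. of_real (1 / d j) = z}"
      by (rule bij_betw_Collect[OF \<tau>(1)]) simp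
    from bij_betw_same_card[OF this]
    show "card {j\<in>{1..k}. of_real (((\<lambda>j. 1 / d j) \<circ> \<tau>) j) = z} = order z (charpoly ?M)"
      unfolding order[OF z] o_def .
  qed (rule \<tau>(2))
  \<comment> \<open>The enumeration \<open>c\<close> is arbitrary. It has the same multiplicities as
    the reciprocals 1 / d_j, so a permutation of \<open>I\<close> matches the two families.\<close>
  have all: "\<exists>\<sigma>. bij_betw \<sigma> I I \<and> (\<forall>j\<in>I.
      (\<lambda>\<beta>. \<zeta> (\<sigma> j) \<beta> - (- \<i> * complex_of_real (1 / c (j - k) * (1 / \<beta>))))
        \<in> O[at_top](\<lambda>\<beta>. complex_of_real (1 / \<beta>\<^sup>2)))"
    if c: "nonzero_eigenvalues ?M k c" for c
  proof -
    have c_pos: "c (j - k) > 0" if "j \<in> I" for j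
    proof -
      have "j - k \<in> {1..k}"
        using that by (auto simp: I_def)
      with c show ?thesis
        unfolding nonzero_eigenvalues_def by blast
    qed
    have c0: "c (j - k) \<noteq> 0" if "j \<in> I" for j
      using c_pos[OF that] by simp
    have "card {j\<in>I. complex_of_real (c (j - k)) = z} = card {j\<in>I. complex_of_real (1 / d j) = z}" for z
    proof (cases "z = 0")
      case True
      \<comment> \<open>\<open>nonzero_eigenvalues\<close> fixes multiplicities only at
        \<open>z \<noteq> 0\<close>; over 0 both fibres are empty, as all values involved are
        nonzero.\<close>
      have "{j\<in>I. complex_of_real (c (j - k)) = z} = {}" "{j\<in>I. complex_of_real (1 / d j) = z} = {}"
        using c0 d0 True by auto
      then show ?thesis
        by (simp only:)
    next
      case False
      \<comment> \<open>The shift by \<open>k\<close> translates between eigenpairs numbered from k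
        + 1 and eigenvalues numbered from 1.\<close>
      have "bij_betw (\<lambda>j. j - k) I {1..k}"
        by (rule bij_betw_byWitness[where f' = "\<lambda>j. j + k"]) (auto simp: I_def)
      from bij_betw_Collect[OF this, of "\<lambda>j. complex_of_real (c j) = z"]
      have "bij_betw (\<lambda>j. j - k) {j\<in>I. complex_of_real (c (j - k)) = z}
          {j\<in>{1..k}. complex_of_real (c j) = z}"
        by simp
      then have "card {j\<in>I. complex_of_real (c (j - k)) = z} =
          card {j\<in>{1..k}. complex_of_real (c j) = z}"
        by (rule bij_betw_same_card)
      also have "\<dots> = order z (charpoly ?M)"
        using c False unfolding nonzero_eigenvalues_def by simp
      finally show ?thesis
        unfolding order[OF False] .
    qed
    from bij_betw_fibers[OF I(1) I(1) this]
    obtain \<sigma> where \<sigma>: "bij_betw \<sigma> I I"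
      and \<sigma>_eq: "\<forall>j\<in>I. complex_of_real (1 / d (\<sigma> j)) = complex_of_real (c (j - k))"
      by blast
    have "(\<lambda>\<beta>. \<zeta> (\<sigma> j) \<beta> - (- \<i> * complex_of_real (1 / c (j - k) * (1 / \<beta>))))
        \<in> O[at_top](\<lambda>\<beta>. complex_of_real (1 / \<beta>\<^sup>2))" if j: "j \<in> I" for j
    proof -
      have \<sigma>j: "\<sigma> j \<in> I"
        using bij_betw_apply[OF \<sigma> j] .
      \<comment> \<open>With this equation and \<open>\<rho> (\<sigma> j) = 0\<close> the low-loss
        expansion of the eigenvalue with index \<open>\<sigma> j\<close> becomes the claim.\<close>
      have "c (j - k) = 1 / d (\<sigma> j)"
        using bspec[OF \<sigma>_eq j] by (simp only: of_real_eq_iff)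
      moreover have "\<rho> (\<sigma> j) = 0"
        using zero_indexing[of "\<sigma> j"] \<sigma>j k by (auto simp: I_def k_def)
      moreover have "\<sigma> j \<in> {k+1..CARD('n + 'n)}"
        using \<sigma>j k by (simp add: I_def)
      then have "(\<lambda>\<beta>. \<zeta> (\<sigma> j) \<beta> - (of_real (\<rho> (\<sigma> j)) - \<i> * of_real (d (\<sigma> j) / \<beta>)))
          \<in> O[at_top](\<lambda>\<beta>. complex_of_real (1 / \<beta>\<^sup>2))"
        by (rule eigenpair_asymptoticsD(5)[OF asym])
      ultimately show ?thesis
        by simp
    qed
    with \<sigma> show ?thesis
      by blast
  qed
  show ?thesis
    unfolding k_def[symmetric] I_def[symmetric]
    by (rule conjI, rule exI, rule ex) (intro allI impI all)
qed

end
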